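(* Let $X$ be a locally compact Hausdorff space and let $\mathbf{F}$ be a normed space of continuous functions (NSCF) over $X$. Then: (i) If $\mathbf{F}$ is $2$-independent, $\mathbf{E}$ is an NSCF over $X$, and $\omega:X\to\mathbb{F}$ is a map with $M_{\omega}\mathbf{F}\subset\mathbf{E}$, then $\omega$ is continuous. (ii) If $\mathbf{F}$ generates the topology of $X$, $\mathbf{E}$ is an NSCF over a locally compact Hausdorff space $Y$, and $\Phi:Y\to X$ is a map with $C_{\Phi}\mathbf{F}\subset\mathbf{E}$, then $\Phi$ is continuous. (iii) If $1\in\mathbf{F}$ and $\mathbf{F}$ generates the topology of $X$, $\mathbf{E}$ is an NSCF over a locally compact Hausdorff space $Y$, and $\Phi:Y\to X$ and $\omega:Y\to\mathbb{F}\setminus\{0\}$ are maps with $W_{\Phi,\omega}\mathbf{F}\subset\mathbf{E}$, then both $\Phi$ and $\omega$ are continuous.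
   Context: $\mathbb{F}$ is $\mathbb{R}$ or $\mathbb{C}$. $\mathcal{C}(X)$ is the space of continuous $\mathbb{F}$-valued functions on $X$ with the compact-open topology. A normed space of continuous functions (NSCF) over $X$ is a linear subspace $\mathbf{F}\subset\mathcal{C}(X)$ equipped with a norm such that the inclusion $\mathbf{F}\to\mathcal{C}(X)$ is continuous. For maps $\Phi:Y\to X$, $\omega:Y\to\mathbb{F}$ and $f:X\to\mathbb{F}$: $[W_{\Phi,\omega}f](y)=\omega(y)f(\Phi(y))$; $C_\Phi=W_{\Phi,1}$ (composition operator); if $X=Y$, $M_\omega=W_{\mathrm{Id},\omega}$ (multiplication operator). For $x\in X$, $x_{\mathbf{F}}:\mathbf{F}\to\mathbb{F}$ is the point evaluation $x_{\mathbf{F}}(f)=f(x)$. $\mathbf{F}$ is $2$-independent if $x_{\mathbf{F}}$ and $y_{\mathbf{F}}$ are linearly independent for every distinct $x,y\in X$. $\mathbf{F}$ generates the topology of $X$ if the topology of $X$ coincides with the smallest topology on $X$ making all elements of $\mathbf{F}$ continuous. *)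

theory Defs
  imports "HOL-Analysis.Analysis"
begin

text \<open>
  The scalar field is a type of class \<open>real_normed_field\<close>. Its instances include \<open>real\<close> and
  \<open>complex\<close>, and by the Gelfand--Mazur theorem every instance is isometrically isomorphic to
  one of these two.

  A topological space is an \<open>'a topology\<close>. A function on \<open>topspace X\<close> is represented by its
  extension by zero to the whole type, so that equality and the pointwise operations
  on these representatives are those of functions on \<open>topspace X\<close>.
\<close>

definition zero_ext :: "'a topology \<Rightarrow> ('a \<Rightarrow> 'k::zero) \<Rightarrow> 'a \<Rightarrow> 'k"
  where "zero_ext X f = (\<lambda>x. if x \<in> topspace X then f x else 0)"

definition cont_funs :: "'a topology \<Rightarrow> ('a \<Rightarrow> 'k::real_normed_field) set"
  where "cont_funs X =
    {f. continuous_map X euclidean f \<and> (\<forall>x. x \<notin> topspace X \<longrightarrow> f x = 0)}"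

definition compact_open_topology :: "'a topology \<Rightarrow> ('a \<Rightarrow> 'k::real_normed_field) topology"
  where "compact_open_topology X =
    topology_generated_by
      {{f \<in> cont_funs X. f ` K \<subseteq> U} | K U. compactin X K \<and> open U}"

lemma topspace_compact_open_topology: "topspace (compact_open_topology X) = cont_funs X"
proof -
  have "cont_funs X \<in> {{f \<in> cont_funs X. f ` K \<subseteq> U} | K U. compactin X K \<and> open U}"
    by (rule CollectI, rule exI[of _ "{}"], rule exI[of _ UNIV]) auto
  then show ?thesis
    unfolding compact_open_topology_def topology_generated_by_topspace by blast
qed

locale normed_function_space =
  fixes F :: "('a \<Rightarrow> 'k::real_normed_field) set"
    and N :: "('a \<Rightarrow> 'k) \<Rightarrow> real"
  assumes zero_mem: "(\<lambda>x. 0) \<in> F"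
    and add_mem: "\<lbrakk>f \<in> F; g \<in> F\<rbrakk> \<Longrightarrow> (\<lambda>x. f x + g x) \<in> F"
    and scale_mem: "f \<in> F \<Longrightarrow> (\<lambda>x. c * f x) \<in> F"
    and norm_nonneg: "f \<in> F \<Longrightarrow> 0 \<le> N f"
    and norm_eq_0_iff: "f \<in> F \<Longrightarrow> N f = 0 \<longleftrightarrow> f = (\<lambda>x. 0)"
    and norm_scale: "f \<in> F \<Longrightarrow> N (\<lambda>x. c * f x) = norm c * N f"
    and norm_triangle: "\<lbrakk>f \<in> F; g \<in> F\<rbrakk> \<Longrightarrow> N (\<lambda>x. f x + g x) \<le> N f + N g"
begin

lemma diff_mem:
  assumes "f \<in> F" "g \<in> F"
  shows "(\<lambda>x. f x - g x) \<in> F"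
  using add_mem[OF assms(1) scale_mem[OF assms(2), of "-1"]] by simp

lemma norm_diff_commute:
  assumes "f \<in> F" "g \<in> F"
  shows "N (\<lambda>x. f x - g x) = N (\<lambda>x. g x - f x)"
  using norm_scale[OF diff_mem[OF assms], of "-1"] by simp

text \<open>The locale \<open>Metric_space\<close> wants a distance that is total, hence the value off \<open>F\<close>.\<close>

definition norm_dist :: "('a \<Rightarrow> 'k) \<Rightarrow> ('a \<Rightarrow> 'k) \<Rightarrow> real"
  where "norm_dist f g = (if f \<in> F \<and> g \<in> F then N (\<lambda>x. f x - g x) else 0)"

sublocale Metric_space F norm_dist
proof
  show "0 \<le> norm_dist f g" for f g
    by (simp add: norm_dist_def norm_nonneg diff_mem)
  show "norm_dist f g = norm_dist g f" for f g
    using norm_diff_commute by (auto simp: norm_dist_def)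
  show "norm_dist f g = 0 \<longleftrightarrow> f = g" if "f \<in> F" "g \<in> F" for f g
    using that by (simp add: norm_dist_def norm_eq_0_iff diff_mem fun_eq_iff)
  show "norm_dist f h \<le> norm_dist f g + norm_dist g h"
    if "f \<in> F" "g \<in> F" "h \<in> F" for f g h
    using that norm_triangle[OF diff_mem diff_mem, of f g g h] by (simp add: norm_dist_def)
qed

end

locale NSCF = normed_function_space F N
  for X :: "'a topology" and F :: "('a \<Rightarrow> 'k::real_normed_field) set" and N +
  assumes subset_cont_funs: "F \<subseteq> cont_funs X"
    and continuous_inclusion: "continuous_map mtopology (compact_open_topology X) (\<lambda>f. f)"

definition weighted_comp ::
    "'b topology \<Rightarrow> ('b \<Rightarrow> 'a) \<Rightarrow> ('b \<Rightarrow> 'k::real_normed_field) \<Rightarrow> ('a \<Rightarrow> 'k) \<Rightarrow> 'b \<Rightarrow> 'k"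
  where "weighted_comp Y \<Phi> \<omega> f = zero_ext Y (\<lambda>y. \<omega> y * f (\<Phi> y))"

definition comp_op :: "'b topology \<Rightarrow> ('b \<Rightarrow> 'a) \<Rightarrow> ('a \<Rightarrow> 'k::real_normed_field) \<Rightarrow> 'b \<Rightarrow> 'k"
  where "comp_op Y \<Phi> = weighted_comp Y \<Phi> (\<lambda>y. 1)"

definition mult_op :: "'a topology \<Rightarrow> ('a \<Rightarrow> 'k::real_normed_field) \<Rightarrow> ('a \<Rightarrow> 'k) \<Rightarrow> 'a \<Rightarrow> 'k"
  where "mult_op X \<omega> = weighted_comp X id \<omega>"

definition point_eval :: "('a \<Rightarrow> 'k) set \<Rightarrow> 'a \<Rightarrow> ('a \<Rightarrow> 'k) \<Rightarrow> 'k"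
  where "point_eval F x = (\<lambda>f\<in>F. f x)"

text \<open>
  Linear independence of the pair \<open>(\<phi>, \<psi>)\<close> of functionals on \<open>F\<close>; as a family, so that
  \<open>(\<phi>, \<phi>)\<close> is dependent.
\<close>

definition lin_indep_pair ::
    "('a \<Rightarrow> 'k) set \<Rightarrow> (('a \<Rightarrow> 'k) \<Rightarrow> 'k::real_normed_field) \<Rightarrow> (('a \<Rightarrow> 'k) \<Rightarrow> 'k) \<Rightarrow> bool"
  where "lin_indep_pair F \<phi> \<psi> \<longleftrightarrow>
    (\<forall>a b. (\<forall>f\<in>F. a * \<phi> f + b * \<psi> f = 0) \<longrightarrow> a = 0 \<and> b = 0)"

definition two_independent :: "'a topology \<Rightarrow> ('a \<Rightarrow> 'k::real_normed_field) set \<Rightarrow> bool"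
  where "two_independent X F \<longleftrightarrow>
    (\<forall>x\<in>topspace X. \<forall>y\<in>topspace X. x \<noteq> y \<longrightarrow>
      lin_indep_pair F (point_eval F x) (point_eval F y))"

definition makes_continuous :: "'a topology \<Rightarrow> ('a \<Rightarrow> 'k::real_normed_field) set \<Rightarrow> bool"
  where "makes_continuous T F \<longleftrightarrow> (\<forall>f\<in>F. continuous_map T euclidean f)"

definition generates_topology :: "'a topology \<Rightarrow> ('a \<Rightarrow> 'k::real_normed_field) set \<Rightarrow> bool"
  where "generates_topology X F \<longleftrightarrow>
    makes_continuous X F \<and>
    (\<forall>T. topspace T = topspace X \<and> makes_continuous T F \<longrightarrow>
      (\<forall>U. openin X U \<longrightarrow> openin T U))"

end

theory Submission
  imports Defs
begin

lemma cont_funs_imp_continuous_map: "f \<in> cont_funs X \<Longrightarrow> continuous_map X euclidean f"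
  by (simp add: cont_funs_def)

lemma NSCF_imp_continuous_map:
  "\<lbrakk>NSCF X F N; f \<in> F\<rbrakk> \<Longrightarrow> continuous_map X euclidean f"
  using NSCF.subset_cont_funs cont_funs_imp_continuous_map by blast

text \<open>Elements of \<open>E\<close> are continuous on \<open>Y\<close>, and extension by zero
  changes nothing on \<open>topspace Y\<close>. Of the inclusion of the image in \<open>E\<close>,
  the proof uses only this consequence.\<close>

lemma NSCF_weighted_comp_continuous_map:
  assumes "NSCF Y E NE" and "weighted_comp Y \<Phi> \<omega> ` F \<subseteq> E" and "f \<in> F"
  shows "continuous_map Y euclidean (\<lambda>y. \<omega> y * f (\<Phi> y))"
proof (rule continuous_map_eq)
  show "continuous_map Y euclidean (weighted_comp Y \<Phi> \<omega> f)"
    using assms NSCF_imp_continuous_map by blast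
qed (simp add: weighted_comp_def zero_ext_def)

text \<open>Near \<open>x\<close> the function \<open>\<omega>\<close> is the quotient of the
  continuous functions \<open>\<omega> * f\<close> and \<open>f\<close>. Continuity is local, so
  \<open>f\<close> may depend on \<open>x\<close>.\<close>

lemma continuous_map_of_mult:
  fixes \<omega> :: "'a \<Rightarrow> 'k::real_normed_field"
  assumes "\<And>x. x \<in> topspace X \<Longrightarrow> \<exists>f. continuous_map X euclidean f \<and> f x \<noteq> 0 \<and>
             continuous_map X euclidean (\<lambda>z. \<omega> z * f z)"
  shows "continuous_map X euclidean \<omega>"
  unfolding continuous_map_atin limitin_canonical_iff
proof
  fix x assume "x \<in> topspace X"
  then obtain f where f: "(f \<longlongrightarrow> f x) (atin X x)" "f x \<noteq> 0"
    and \<omega>f: "((\<lambda>z. \<omega> z * f z) \<longlongrightarrow> \<omega> x * f x) (atin X x)"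
    using assms unfolding continuous_map_atin limitin_canonical_iff by metis
  \<comment> \<open>As \<open>f\<close> tends to \<open>f x \<noteq> 0\<close>, it has no zeros in
    some punctured neighbourhood of \<open>x\<close>, so it cancels there.\<close>
  have "\<forall>\<^sub>F z in atin X x. \<omega> z * f z / f z = \<omega> z"
    using tendsto_imp_eventually_ne[OF f] by eventually_elim simp
  from Lim_transform_eventually[OF tendsto_divide[OF \<omega>f f] this] f(2)
  show "(\<omega> \<longlongrightarrow> \<omega> x) (atin X x)" by simp
qed

text \<open>A zero functional is dependent with any other, so evaluation at \<open>x\<close> cannot
  vanish on \<open>F\<close>. The second point \<open>y\<close> is there because 2-independence
  speaks only about pairs of distinct points.\<close>

lemma two_independent_nonvanishing:
  assumes "two_independent X F" and "x \<in> topspace X" "y \<in> topspace X" "x \<noteq> y"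
  obtains f where "f \<in> F" "f x \<noteq> 0"
proof -
  have "lin_indep_pair F (point_eval F x) (point_eval F y)"
    using assms by (simp add: two_independent_def)
  \<comment> \<open>If every \<open>f\<close> vanished at \<open>x\<close>, the coefficients
    \<open>(1, 0)\<close> would give a nontrivial relation.\<close>
  then have "\<not> (\<forall>f\<in>F. 1 * point_eval F x f + 0 * point_eval F y f = 0)"
    unfolding lin_indep_pair_def by (metis zero_neq_one)
  with that show thesis by (auto simp: point_eval_def)
qed

text \<open>Every preimage is empty or the whole space. This settles the case in which
  2-independence is vacuous.\<close>

lemma continuous_map_from_singleton:
  assumes "topspace X \<subseteq> {x}" and "f ` topspace X \<subseteq> topspace Z"
  shows "continuous_map X Z f"
proof -
  have "openin X {z \<in> topspace X. f z \<in> U}" for U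
  proof -
    have "{z \<in> topspace X. f z \<in> U} = {} \<or> {z \<in> topspace X. f z \<in> U} = topspace X"
      using assms(1) by blast
    then show ?thesis by (metis openin_empty openin_topspace)
  qed
  then show ?thesis
    using assms(2) by (simp add: continuous_map_def image_subset_iff_funcset)
qed

text \<open>
  The sets whose preimage under \<open>\<Phi>\<close> is open form a topology that makes \<open>F\<close> continuous,
  so that it is finer than the topology generated by \<open>F\<close>.
\<close>

lemma continuous_map_into_generated:
  fixes F :: "('a \<Rightarrow> 'k::real_normed_field) set"
  assumes gen: "generates_topology X F"
    and \<Phi>: "\<Phi> \<in> topspace Y \<rightarrow> topspace X"
    and F: "\<And>f. f \<in> F \<Longrightarrow> continuous_map Y euclidean (\<lambda>y. f (\<Phi> y))"
  shows "continuous_map Y X \<Phi>"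
proof -
  \<comment> \<open>The restriction to subsets of \<open>topspace X\<close> makes
    \<open>topspace X\<close> the carrier of \<open>topology P\<close>;
    \<open>generates_topology\<close> compares \<open>X\<close> only with topologies on that
    carrier.\<close>
  define P where "P U \<longleftrightarrow> U \<subseteq> topspace X \<and> openin Y {y \<in> topspace Y. \<Phi> y \<in> U}" for U
  have "istopology P"
    unfolding istopology_def
  proof (intro conjI allI impI)
    fix S T assume "P S" "P T"
    moreover have "{y \<in> topspace Y. \<Phi> y \<in> S \<inter> T} =
        {y \<in> topspace Y. \<Phi> y \<in> S} \<inter> {y \<in> topspace Y. \<Phi> y \<in> T}" by auto
    ultimately show "P (S \<inter> T)" by (auto simp: P_def)
  next
    fix \<K> assume "\<forall>K\<in>\<K>. P K"
    moreover have "{y \<in> topspace Y. \<Phi> y \<in> \<Union>\<K>} = (\<Union>K\<in>\<K>. {y \<in> topspace Y. \<Phi> y \<in> K})" by auto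
    ultimately show "P (\<Union>\<K>)" by (auto simp: P_def)
  qed
  then have openin_P: "openin (topology P) = P"
    by (simp add: topology_inverse')
  have "{y \<in> topspace Y. \<Phi> y \<in> topspace X} = topspace Y"
    using \<Phi> by auto
  then have "P (topspace X)"
    by (simp add: P_def)
  then have top: "topspace (topology P) = topspace X"
    unfolding topspace_def[of "topology P"] openin_P by (auto simp: P_def)
  have "makes_continuous (topology P) F"
    unfolding makes_continuous_def continuous_map_def top openin_P
  proof (intro ballI conjI allI impI)
    fix f and V :: "'k set" assume "f \<in> F" "openin euclidean V"
    then have "openin Y {y \<in> topspace Y. f (\<Phi> y) \<in> V}"
      using F by (auto simp: continuous_map_def)
    moreover have "{y \<in> topspace Y. \<Phi> y \<in> {x \<in> topspace X. f x \<in> V}} =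
        {y \<in> topspace Y. f (\<Phi> y) \<in> V}" using \<Phi> by auto
    ultimately show "P {x \<in> topspace X. f x \<in> V}" by (simp add: P_def)
  qed simp
  then have "P U" if "openin X U" for U
    using gen top that openin_P by (metis generates_topology_def)
  then show ?thesis
    using \<Phi> by (simp add: continuous_map_def P_def)
qed

theorem corollary3p3:
  fixes X :: "'a topology"
    and F :: "('a \<Rightarrow> 'k::real_normed_field) set"
    and N :: "('a \<Rightarrow> 'k) \<Rightarrow> real"
  assumes "locally_compact_space X" and "Hausdorff_space X"
    and "NSCF X F N"
  shows
    "(\<forall>(E :: ('a \<Rightarrow> 'k) set) NE (\<omega> :: 'a \<Rightarrow> 'k).
        two_independent X F \<and> NSCF X E NE \<and> mult_op X \<omega> ` F \<subseteq> E
        \<longrightarrow> continuous_map X euclidean \<omega>) \<and>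
     (\<forall>(Y :: 'b topology) (E :: ('b \<Rightarrow> 'k) set) NE (\<Phi> :: 'b \<Rightarrow> 'a).
        generates_topology X F \<and>
        locally_compact_space Y \<and> Hausdorff_space Y \<and> NSCF Y E NE \<and>
        \<Phi> \<in> topspace Y \<rightarrow> topspace X \<and> comp_op Y \<Phi> ` F \<subseteq> E
        \<longrightarrow> continuous_map Y X \<Phi>) \<and>
     (\<forall>(Y :: 'b topology) (E :: ('b \<Rightarrow> 'k) set) NE (\<Phi> :: 'b \<Rightarrow> 'a) (\<omega> :: 'b \<Rightarrow> 'k).
        zero_ext X (\<lambda>x. 1) \<in> F \<and> generates_topology X F \<and>
        locally_compact_space Y \<and> Hausdorff_space Y \<and> NSCF Y E NE \<and>
        \<Phi> \<in> topspace Y \<rightarrow> topspace X \<and> \<omega> \<in> topspace Y \<rightarrow> UNIV - {0} \<and>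
        weighted_comp Y \<Phi> \<omega> ` F \<subseteq> E
        \<longrightarrow> continuous_map Y X \<Phi> \<and> continuous_map Y euclidean \<omega>)"
proof (intro conjI allI impI)
  fix E :: "('a \<Rightarrow> 'k) set" and NE and \<omega> :: "'a \<Rightarrow> 'k"
  assume h: "two_independent X F \<and> NSCF X E NE \<and> mult_op X \<omega> ` F \<subseteq> E"
  show "continuous_map X euclidean \<omega>"
  \<comment> \<open>With at most one point, 2-independence allows \<open>F\<close> to be zero, so no
    nonvanishing \<open>f\<close> need exist. Otherwise each \<open>x\<close> has a partner
    \<open>y\<close> and thus an \<open>f\<close> in \<open>F\<close> with
    \<open>f x \<noteq> 0\<close>.\<close>
  proof (cases "\<exists>x. topspace X \<subseteq> {x}")
    case True
    then show ?thesis by (auto intro: continuous_map_from_singleton)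
  next
    case False
    show ?thesis
    proof (rule continuous_map_of_mult)
      fix x assume x: "x \<in> topspace X"
      from False obtain y where "y \<in> topspace X" "x \<noteq> y" by auto
      then obtain f where f: "f \<in> F" "f x \<noteq> 0"
        using two_independent_nonvanishing h x by metis
      moreover have "continuous_map X euclidean (\<lambda>z. \<omega> z * f z)"
        using NSCF_weighted_comp_continuous_map[of X E NE id \<omega> F f] h f(1)
        by (simp add: mult_op_def)
      ultimately show "\<exists>f. continuous_map X euclidean f \<and> f x \<noteq> 0 \<and>
          continuous_map X euclidean (\<lambda>z. \<omega> z * f z)"
        using NSCF_imp_continuous_map[OF assms(3)] by blast
    qed
  qed
next
  fix Y :: "'b topology" and E :: "('b \<Rightarrow> 'k) set" and NE and \<Phi> :: "'b \<Rightarrow> 'a"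
  assume h: "generates_topology X F \<and>
    locally_compact_space Y \<and> Hausdorff_space Y \<and> NSCF Y E NE \<and>
    \<Phi> \<in> topspace Y \<rightarrow> topspace X \<and> comp_op Y \<Phi> ` F \<subseteq> E"
  show "continuous_map Y X \<Phi>"
  proof (rule continuous_map_into_generated)
    show "continuous_map Y euclidean (\<lambda>y. f (\<Phi> y))" if "f \<in> F" for f
      using NSCF_weighted_comp_continuous_map[of Y E NE \<Phi> "\<lambda>y. 1" F f] h that
      by (simp add: comp_op_def)
  qed (use h in auto)
next
  fix Y :: "'b topology" and E :: "('b \<Rightarrow> 'k) set" and NE and \<Phi> :: "'b \<Rightarrow> 'a"
    and \<omega> :: "'b \<Rightarrow> 'k"
  assume h: "zero_ext X (\<lambda>x. 1) \<in> F \<and> generates_topology X F \<and>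
    locally_compact_space Y \<and> Hausdorff_space Y \<and> NSCF Y E NE \<and>
    \<Phi> \<in> topspace Y \<rightarrow> topspace X \<and> \<omega> \<in> topspace Y \<rightarrow> UNIV - {0} \<and>
    weighted_comp Y \<Phi> \<omega> ` F \<subseteq> E"
  then have \<Phi>: "\<And>y. y \<in> topspace Y \<Longrightarrow> \<Phi> y \<in> topspace X"
    and \<omega>0: "\<And>y. y \<in> topspace Y \<Longrightarrow> \<omega> y \<noteq> 0" by auto
  have W: "continuous_map Y euclidean (\<lambda>y. \<omega> y * f (\<Phi> y))" if "f \<in> F" for f
    using NSCF_weighted_comp_continuous_map h that by blast
  \<comment> \<open>The weight is the image of the constant 1, because \<open>\<Phi>\<close> maps
    into \<open>topspace X\<close>, where the extension by zero equals 1.\<close>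
  have "continuous_map Y euclidean (\<lambda>y. \<omega> y * zero_ext X (\<lambda>x. 1) (\<Phi> y))"
    using W h by blast
  then show \<omega>: "continuous_map Y euclidean \<omega>"
    by (rule continuous_map_eq) (simp add: zero_ext_def \<Phi>)
  show "continuous_map Y X \<Phi>"
  proof (rule continuous_map_into_generated)
    show "continuous_map Y euclidean (\<lambda>y. f (\<Phi> y))" if "f \<in> F" for f
    \<comment> \<open>The roles are exchanged: the unknown function is \<open>f\<close> composed
      with \<open>\<Phi>\<close>, and the multiplier is \<open>\<omega>\<close>, already shown
      continuous and nowhere zero on \<open>topspace Y\<close>. Dividing by it reduces the claim to
      the case of a composition operator.\<close>
    proof (rule continuous_map_of_mult)
      fix y assume "y \<in> topspace Y"
      with \<omega> \<omega>0 W[OF that] show "\<exists>g. continuous_map Y euclidean g \<and> g y \<noteq> 0 \<and>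
          continuous_map Y euclidean (\<lambda>z. f (\<Phi> z) * g z)"
        by (intro exI[of _ \<omega>]) (simp add: mult.commute)
    qed
  qed (use h in auto)
qed

end
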